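(* Let $k\ge 11$ and let $G$ be a planar (finite simple) graph with maximum degree at most $k$. Then $\operatorname{col}(T(G))\le k+2$.
   Context: The total graph $T(G)$ has vertex set $V(G)\cup E(G)$, two elements adjacent iff they are adjacent or incident in $G$. The coloring number $\operatorname{col}(H)$ of a graph $H$ is the smallest integer $m$ such that there is an ordering of $V(H)$ in which each vertex has at most $m-1$ neighbors among vertices of smaller index. *)

theory Defs
  imports "HOL-Analysis.Analysis"
begin

record 'a graph =
  verts :: "'a set"
  edges :: "'a set set"

definition finite_simple_graph :: "'a graph \<Rightarrow> bool" where
  "finite_simple_graph G \<longleftrightarrow>
     finite (verts G) \<and> (\<forall>e\<in>edges G. e \<subseteq> verts G \<and> card e = 2)"

definition degree :: "'a graph \<Rightarrow> 'a \<Rightarrow> nat" where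
  "degree G v = card {e \<in> edges G. v \<in> e}"

(* The inserted 0 only fixes the maximum degree of the graph without vertices. *)
definition max_degree :: "'a graph \<Rightarrow> nat" where
  "max_degree G = Max (insert 0 (degree G ` verts G))"

(* A plane drawing with the Euclidean plane taken to be the complex numbers: p places the
   vertices and g e is the simple curve drawn for the edge e.  Such a curve passes through
   no vertex other than the two ends of e, and two curves meet only in common ends. *)
definition plane_drawing ::
  "'a graph \<Rightarrow> ('a \<Rightarrow> complex) \<Rightarrow> ('a set \<Rightarrow> real \<Rightarrow> complex) \<Rightarrow> bool" where
  "plane_drawing G p g \<longleftrightarrow>
     inj_on p (verts G) \<and>
     (\<forall>e\<in>edges G. arc (g e) \<and> {pathstart (g e), pathfinish (g e)} = p ` e \<and>
        path_image (g e) \<inter> p ` verts G = p ` e) \<and>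
     (\<forall>e\<in>edges G. \<forall>f\<in>edges G. e \<noteq> f \<longrightarrow>
        path_image (g e) \<inter> path_image (g f) = p ` (e \<inter> f))"

definition planar :: "'a graph \<Rightarrow> bool" where
  "planar G \<longleftrightarrow> (\<exists>p g. plane_drawing G p g)"

definition total_graph :: "'a graph \<Rightarrow> ('a + 'a set) graph" where
  "total_graph G =
     \<lparr> verts = Inl ` verts G \<union> Inr ` edges G,
       edges = {{Inl u, Inl v} | u v. {u, v} \<in> edges G}
             \<union> {{Inr e, Inr f} | e f. e \<in> edges G \<and> f \<in> edges G \<and> e \<noteq> f \<and> e \<inter> f \<noteq> {}}
             \<union> {{Inl v, Inr e} | v e. e \<in> edges G \<and> v \<in> e} \<rparr>"

definition vertex_ordering :: "'a graph \<Rightarrow> 'a list \<Rightarrow> bool" where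
  "vertex_ordering H xs \<longleftrightarrow> distinct xs \<and> set xs = verts H"

(* "At most m - 1" is written as "less than m" to avoid truncated subtraction.  A finite graph
   with a vertex has no suitable m below 1, so minimizing over the naturals agrees with
   minimizing over the integers; the graph without vertices gets the value 0. *)
definition coloring_number :: "'a graph \<Rightarrow> nat" where
  "coloring_number H =
     (LEAST m. \<exists>xs. vertex_ordering H xs \<and>
        (\<forall>i<length xs. card {j. j < i \<and> {xs ! j, xs ! i} \<in> edges H} < m))"

end

(* A vertex set Y of T(G) in which every vertex has at least k + 2 neighbours consists of a set W of
   vertices and a set F of edges of G.  The planar graph formed by F and the edges within W then has
   minimum degree at least 3, and none of its edges uv with d(u) <= 5 has d(u) + d(v) <= 13, against
   Kotzig's theorem on light edges.

   Kotzig's theorem is proved by discharging, with charge d(v) - 6 on the vertices and 2 l(f) - 6 on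
   the faces.  Instead of rotation systems this uses only which complementary components of the
   drawing lie along which edges.  By the Jordan curve theorem and Janiszewski's theorem, erasing an
   edge merges two components or leaves their number unchanged; this gives Euler's inequality and
   two sides for every edge, and it shows that a forest does not separate the plane, so that a face
   has at least four boundary edges or is bounded by a triangle. *)

theory Submission
  imports Defs
begin

section \<open>Arcs with both ends on a compact plane set\<close>

text \<open>The bound 11 is dictated by Kotzig's 13. An edge \<open>uv\<close> in \<open>Y\<close>
  has at most d(u) - 1 + d(v) - 1 neighbouring edges, besides its ends in \<open>W\<close>. If it
  has k + 2 neighbours and at most one end in \<open>W\<close>, then d(u) + d(v) is at least k + 3,
  which exceeds 13 from k = 11 on. The edges within \<open>W\<close> join the planar graph even if
  they are not in \<open>Y\<close>, because two adjacent vertices are neighbours in the total graph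
  whether or not their edge was selected. In the discharging, a payment for each corner between two
  consecutive light edges at a vertex would need the cyclic order of its edges. The surplus of light
  over heavy edge sides at a vertex within a face replaces it: summed over all faces, this is twice
  the number of light edges minus twice the number of heavy edges at the vertex, whatever their
  order. Everything about faces reduces to one dichotomy for an edge drawn last: its ends are
  already joined in the drawing, or the drawing splits into two disjoint closed parts with one end
  in each.\<close>

lemma components_Compl_Un:
  assumes "D \<in> components (- T)" "D \<inter> A = {}"
  shows "D \<in> components (- (T \<union> A))"
proof -
  have D: "connected D" "D \<noteq> {}" "D \<subseteq> - (T \<union> A)"
    using assms in_components_connected in_components_nonempty in_components_subset by blast+
  then obtain C where C: "C \<in> components (- (T \<union> A))" "D \<subseteq> C"
    by (metis exists_component_superset subset_empty)
  then have "C \<subseteq> D"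
    by (intro components_maximal [OF assms(1)])
      (use D in_components_connected in_components_subset in blast)+
  then show ?thesis using C by auto
qed

lemma component_eq_of_mem:
  assumes "D \<in> components S" "x \<in> D"
  shows "D = connected_component_set S x"
  using assms by (metis componentsE connected_component_eq)

text \<open>The typical \<open>T\<close> is a drawing to which the edge \<open>\<gamma>\<close> is
  added. As the arc meets \<open>T\<close> in its ends only, its interior stays within one component
  of the complement.\<close>

locale crosscut =
  fixes T :: "complex set" and \<gamma> :: "real \<Rightarrow> complex"
  assumes compact_T: "compact T" and arc: "arc \<gamma>"
    and meet: "path_image \<gamma> \<inter> T = {pathstart \<gamma>, pathfinish \<gamma>}"
begin

text \<open>The parameter 1/2 merely selects some inner point of the arc; every other inner point
  gives the same component.\<close>

definition cell :: "complex set" where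
  "cell = connected_component_set (- T) (\<gamma> (1/2))"

text \<open>For an edge drawn last, these are the faces on its two sides.\<close>

definition pieces :: "complex set set" where
  "pieces = {D \<in> components (- (T \<union> path_image \<gamma>)). D \<subseteq> cell}"

lemma closed_T: "closed T"
  using compact_T by (rule compact_imp_closed)

lemma compact_arc: "compact (path_image \<gamma>)"
  using arc arc_imp_path compact_path_image by blast

lemma ends_distinct: "pathstart \<gamma> \<noteq> pathfinish \<gamma>"
  using arc arc_distinct_ends by metis

lemma open_arc_connected: "connected (path_image \<gamma> - T)"
proof -
  have "path_image \<gamma> - T = path_image \<gamma> - {pathstart \<gamma>, pathfinish \<gamma>}"
    using meet by blast
  then show ?thesis
    using arc arc_imp_simple_path connected_simple_path_endless by metis
qed

lemma midpoint: "\<gamma> (1/2) \<in> path_image \<gamma> - T"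
proof -
  have "\<gamma> (1/2) \<in> path_image \<gamma>" by (simp add: path_image_def)
  moreover have "inj_on \<gamma> {0..1}" using arc by (simp add: arc_def)
  then have "\<gamma> (1/2) \<noteq> \<gamma> 0" "\<gamma> (1/2) \<noteq> \<gamma> 1"
    by (auto dest!: inj_onD)
  ultimately show ?thesis
    using meet by (auto simp: pathstart_def pathfinish_def)
qed

lemma open_arc_subset_cell: "path_image \<gamma> - T \<subseteq> cell"
  unfolding cell_def
  by (rule connected_component_maximal [OF midpoint open_arc_connected]) auto

lemma cell_component: "cell \<in> components (- T)"
  unfolding cell_def using midpoint by (auto simp: components_def)

lemma open_cell: "open cell"
  using cell_component closed_T open_components by blast

lemma pieces_subset: "pieces \<subseteq> components (- (T \<union> path_image \<gamma>))"
  unfolding pieces_def by blast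

lemma piece_iff:
  assumes "D \<in> components (- (T \<union> path_image \<gamma>))"
  shows "D \<in> pieces \<longleftrightarrow> D \<inter> cell \<noteq> {}"
proof -
  have "D \<noteq> {}" "connected D" "D \<subseteq> - T"
    using assms in_components_nonempty in_components_connected in_components_subset by blast+
  then show ?thesis
    unfolding pieces_def using components_maximal [OF cell_component] assms by blast
qed

text \<open>The open arc lies in \<open>cell\<close>, so every other component survives unchanged,
  and the effect of the arc on the number of components is measured by \<open>pieces\<close>
  alone.\<close>

lemma components_Un_arc:
  "components (- (T \<union> path_image \<gamma>)) = (components (- T) - {cell}) \<union> pieces"
proof (intro equalityI subsetI)
  fix D assume D: "D \<in> components (- (T \<union> path_image \<gamma>))"
  have D': "D \<noteq> {}" "connected D" "D \<subseteq> - T"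
    using D in_components_nonempty in_components_connected in_components_subset by blast+
  show "D \<in> (components (- T) - {cell}) \<union> pieces"
  proof (cases "D \<inter> cell = {}")
    case True
    obtain C where C: "C \<in> components (- T)" "D \<subseteq> C"
      using D' by (metis exists_component_superset subset_empty)
    have "C \<noteq> cell" using True C D' by auto
    then have "C \<inter> cell = {}"
      using C cell_component components_nonoverlap by blast
    then have "C \<inter> path_image \<gamma> = {}"
      using open_arc_subset_cell in_components_subset [OF C(1)] by blast
    then have "C \<in> components (- (T \<union> path_image \<gamma>))"
      using C components_Compl_Un by blast
    then have "C = D"
      using C D D' components_eq by blast
    then show ?thesis using C \<open>C \<noteq> cell\<close> by auto
  next
    case False
    then show ?thesis using piece_iff D by auto
  qed
next
  fix D assume "D \<in> (components (- T) - {cell}) \<union> pieces"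
  then show "D \<in> components (- (T \<union> path_image \<gamma>))"
  proof
    assume D: "D \<in> components (- T) - {cell}"
    then have "D \<inter> cell = {}"
      using cell_component components_nonoverlap by blast
    then have "D \<inter> path_image \<gamma> = {}"
      using open_arc_subset_cell in_components_subset D by blast
    then show ?thesis using D components_Compl_Un by blast
  qed (use pieces_subset in blast)
qed

lemma pieces_disjoint_components: "(components (- T) - {cell}) \<inter> pieces = {}"
proof -
  have "D \<inter> cell = {}" if "D \<in> components (- T) - {cell}" for D
    using cell_component components_nonoverlap that by blast
  moreover have "D \<inter> cell \<noteq> {}" if "D \<in> pieces" for D
    using that piece_iff pieces_subset by blast
  ultimately show ?thesis by blast
qed

lemma piece_of_point:
  assumes "x \<in> cell - path_image \<gamma>"
  shows "connected_component_set (- (T \<union> path_image \<gamma>)) x \<in> pieces"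
proof -
  have x: "x \<in> - (T \<union> path_image \<gamma>)"
    using assms cell_component in_components_subset by blast
  then have "connected_component_set (- (T \<union> path_image \<gamma>)) x \<in> components (- (T \<union> path_image \<gamma>))"
    by (simp add: components_def)
  moreover have "x \<in> connected_component_set (- (T \<union> path_image \<gamma>)) x"
    using x by simp
  ultimately show ?thesis using assms piece_iff by blast
qed

text \<open>An arc cannot swallow the open cell: the inverse of its parametrization would embed a
  nonempty open subset of the plane into the line, against invariance of dimension.\<close>

lemma pieces_nonempty: "pieces \<noteq> {}"
proof -
  have "\<not> cell \<subseteq> path_image \<gamma>"
  proof
    assume cell: "cell \<subseteq> path_image \<gamma>"
    obtain h where h: "homeomorphism {0..1} (path_image \<gamma>) \<gamma> h"
      using arc homeomorphism_arc by metis
    then have "continuous_on (path_image \<gamma>) h"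
      by (simp add: homeomorphism_def)
    moreover have "inj_on h (path_image \<gamma>)"
      using h by (intro inj_on_inverseI [of _ \<gamma>]) (simp add: homeomorphism_def)
    ultimately have "continuous_on cell h" "inj_on h cell"
      using cell continuous_on_subset inj_on_subset by blast+
    moreover have "cell \<noteq> {}"
      using midpoint open_arc_subset_cell by blast
    ultimately have "DIM(complex) \<le> DIM(real)"
      using open_cell invariance_of_dimension [of cell h] by blast
    then show False by simp
  qed
  then show ?thesis using piece_of_point by blast
qed

lemma connected_in_cell:
  assumes "x \<in> cell" "y \<in> cell"
  shows "connected_component (- T) x y"
  using assms connected_component_sym connected_component_trans
  unfolding cell_def mem_Collect_eq by blast

text \<open>A chord in \<open>T\<close> between the ends closes the arc up to a Jordan curve \<open>J\<close> that meets
  \<open>T\<close> in the connected set \<open>J \<inter> T\<close>, so Janiszewski's theorem applies to \<open>J\<close> and \<open>T\<close>.\<close>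

lemma joined_card_pieces:
  assumes "path_component T (pathstart \<gamma>) (pathfinish \<gamma>)"
  shows "card pieces = 2"
proof -
  obtain K where K: "path K" "path_image K \<subseteq> T" "pathstart K = pathstart \<gamma>"
      "pathfinish K = pathfinish \<gamma>"
    using assms unfolding path_component_def by blast
  then obtain c where c: "arc c" "path_image c \<subseteq> T" "pathstart c = pathstart \<gamma>"
      "pathfinish c = pathfinish \<gamma>"
    using path_contains_arc [OF K(1), of "pathstart \<gamma>" "pathfinish \<gamma>"] ends_distinct
    by (metis order_trans)
  define J where "J = path_image (\<gamma> +++ reversepath c)"
  have J: "J = path_image \<gamma> \<union> path_image c"
    unfolding J_def using c by (simp add: path_image_join)
  have c_ends: "pathstart \<gamma> \<in> path_image c" "pathfinish \<gamma> \<in> path_image c"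
    using c(3,4) [symmetric] by (simp_all add: pathstart_in_path_image pathfinish_in_path_image)
  have JT: "J \<inter> T = path_image c"
  proof -
    have "J \<inter> T = (path_image \<gamma> \<inter> T) \<union> (path_image c \<inter> T)"
      unfolding J by (rule Int_Un_distrib2)
    also have "path_image c \<inter> T = path_image c" using c(2) by (rule Int_absorb2)
    finally show ?thesis using c_ends unfolding meet by auto
  qed
  have loop: "simple_path (\<gamma> +++ reversepath c)" "pathfinish (\<gamma> +++ reversepath c) = pathstart (\<gamma> +++ reversepath c)"
  proof -
    have "path_image \<gamma> \<inter> path_image c \<subseteq> {pathstart \<gamma>, pathfinish \<gamma>}"
      using meet c(2) by blast
    then show "simple_path (\<gamma> +++ reversepath c)"
      using c arc by (intro simple_path_join_loop) (auto simp: arc_reversepath)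
  qed (use c in simp)
  note jordan = Jordan_inside_outside [OF loop, folded J_def]
  have sides: "inside J \<union> outside J = - J" "inside J \<inter> outside J = {}"
    "connected (inside J)" "connected (outside J)" "open (inside J)" "open (outside J)"
    "frontier (inside J) = J" "frontier (outside J) = J"
    using jordan by auto
  let ?S = "T \<union> path_image \<gamma>"
  have JS: "J \<subseteq> ?S" and S_eq: "?S = J \<union> T" using J c(2) by auto
  have cell_J: "x \<in> inside J \<or> x \<in> outside J" if "x \<in> cell - path_image \<gamma>" for x
  proof -
    have "x \<notin> T" using that cell_component in_components_subset by blast
    then show ?thesis using that sides(1) J c(2) by blast
  qed
  \<comment> \<open>Points of the cell are not separated by \<open>T\<close>. If \<open>J\<close>
    does not separate them either, the union of the two does not, since \<open>J \<inter> T\<close>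
    is connected.\<close>
  have joined: "connected_component (- ?S) x y"
    if "x \<in> cell" "y \<in> cell" "connected_component (- J) x y" for x y
  proof -
    have "compact J" unfolding J_def
      using loop(1) simple_path_imp_path compact_path_image by blast
    moreover have "connected (J \<inter> T)"
      unfolding JT using c(1) arc_imp_path connected_path_image by blast
    ultimately show ?thesis
      unfolding S_eq using Janiszewski closed_T that connected_in_cell by blast
  qed
  have z: "\<gamma> (1/2) \<in> cell" "\<gamma> (1/2) \<in> J"
    using midpoint open_arc_subset_cell J by blast+
  \<comment> \<open>The midpoint of the arc lies on \<open>J\<close> and in the open cell. As
    \<open>J\<close> is the frontier of its inside and of its outside, the cell reaches into
    both.\<close>
  have meets: "\<exists>x. x \<in> cell \<and> x \<in> U" if "frontier U = J" for U
  proof -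
    have "\<gamma> (1/2) \<in> closure U" using z that unfolding frontier_def by blast
    then show ?thesis using z(1) open_cell closure_iff_nhds_not_empty by blast
  qed
  obtain a where a: "a \<in> cell" "a \<in> inside J" using meets sides by blast
  obtain b where b: "b \<in> cell" "b \<in> outside J" using meets sides by blast
  have ab: "a \<notin> path_image \<gamma>" "b \<notin> path_image \<gamma>"
    using a b sides(1) J by blast+
  let ?P = "\<lambda>x. connected_component_set (- ?S) x"
  have P_eq: "?P x = ?P y" if "x \<in> cell" "y \<in> cell" "connected U" "U \<subseteq> - J" "x \<in> U" "y \<in> U" for x y U
  proof -
    have "connected_component (- J) x y"
      using that by (auto simp: connected_component_def)
    then show ?thesis
      using joined that connected_component_eq by blast
  qed
  have in_sides: "D = ?P a \<or> D = ?P b" if "D \<in> pieces" for D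
  proof -
    have D: "D \<in> components (- ?S)" "D \<subseteq> cell" using that unfolding pieces_def by auto
    then obtain x where x: "x \<in> D" using in_components_nonempty by blast
    then have "x \<in> cell - path_image \<gamma>" using D in_components_subset by blast
    moreover have "inside J \<subseteq> - J" "outside J \<subseteq> - J" using sides(1) by blast+
    ultimately have "?P x = ?P a \<or> ?P x = ?P b"
      using P_eq [OF _ a(1) sides(3) _ _ a(2)] P_eq [OF _ b(1) sides(4) _ _ b(2)] cell_J [of x]
      by fastforce
    moreover have "D = ?P x" using component_eq_of_mem [OF D(1) x] .
    ultimately show ?thesis by simp
  qed
  have "?P a \<noteq> ?P b"
  proof
    assume eq: "?P a = ?P b"
    have "a \<in> - ?S" "b \<in> - ?S"
      using a b ab cell_component in_components_subset by blast+
    then have "a \<in> ?P a" "b \<in> ?P b" by simp_all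
    then have ab_in: "a \<in> ?P a" "b \<in> ?P a" unfolding eq by simp_all
    have "?P a \<subseteq> - J" using connected_component_subset JS by blast
    then have "?P a \<inter> frontier (inside J) = {}" using sides by blast
    moreover have "?P a \<inter> inside J \<noteq> {}" "?P a - inside J \<noteq> {}"
      using ab_in a b sides by blast+
    ultimately show False
      using connected_Int_frontier connected_connected_component by metis
  qed
  moreover have "?P a \<in> pieces" "?P b \<in> pieces"
    using piece_of_point a b ab by blast+
  ultimately have "pieces = {?P a, ?P b}" "?P a \<noteq> ?P b" using in_sides by blast+
  then show ?thesis by simp
qed

text \<open>An arc does not separate the plane. Attaching first \<open>A\<close> and then
  \<open>B\<close> to it adds each time a set that meets the previous one in a single point, so
  Janiszewski's theorem applies twice.\<close>

lemma separated_connected: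
  assumes AB: "T = A \<union> B" "closed A" "closed B" "A \<inter> B = {}"
    and ends: "pathstart \<gamma> \<in> A" "pathfinish \<gamma> \<in> B"
    and xy: "connected_component (- T) x y" "x \<notin> path_image \<gamma>" "y \<notin> path_image \<gamma>"
  shows "connected_component (- (T \<union> path_image \<gamma>)) x y"
proof -
  have A: "path_image \<gamma> \<inter> A = {pathstart \<gamma>}" and B: "(path_image \<gamma> \<union> A) \<inter> B = {pathfinish \<gamma>}"
  proof -
    have "path_image \<gamma> \<inter> A = {pathstart \<gamma>, pathfinish \<gamma>} \<inter> A"
      "path_image \<gamma> \<inter> B = {pathstart \<gamma>, pathfinish \<gamma>} \<inter> B"
      unfolding meet [symmetric] using AB(1) by blast+
    then show "path_image \<gamma> \<inter> A = {pathstart \<gamma>}" "(path_image \<gamma> \<union> A) \<inter> B = {pathfinish \<gamma>}"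
      using AB(4) ends by auto
  qed
  have "connected (- path_image \<gamma>)"
    using arc by (intro path_connected_imp_connected path_connected_arc_complement) auto
  then have "connected_component (- path_image \<gamma>) x y"
    using xy by (auto simp: connected_component_def)
  moreover have "connected_component (- A) x y" "connected_component (- B) x y"
    using xy(1) AB by (meson Compl_anti_mono Un_upper1 Un_upper2 connected_component_of_subset)+
  ultimately have "connected_component (- (A \<union> path_image \<gamma>)) x y"
    using Janiszewski [of "path_image \<gamma>" A x y] A \<open>closed A\<close> compact_arc by (simp add: Un_commute)
  moreover have "compact A"
    using compact_T AB by (metis Un_upper1 closed_Int_compact inf.absorb_iff1)
  ultimately have "connected_component (- ((A \<union> path_image \<gamma>) \<union> B)) x y"
    using Janiszewski [of "A \<union> path_image \<gamma>" B x y] B AB(3) compact_arc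
      \<open>connected_component (- B) x y\<close>
    by (simp add: compact_Un Un_commute)
  moreover have "(A \<union> path_image \<gamma>) \<union> B = T \<union> path_image \<gamma>"
    using AB by blast
  ultimately show ?thesis by simp
qed

lemma separated_card_pieces:
  assumes "T = A \<union> B" "closed A" "closed B" "A \<inter> B = {}"
    "pathstart \<gamma> \<in> A" "pathfinish \<gamma> \<in> B"
  shows "card pieces = 1"
proof -
  let ?S = "T \<union> path_image \<gamma>"
  obtain D where D: "D \<in> pieces" using pieces_nonempty by blast
  have "C = D" if C: "C \<in> pieces" for C
  proof -
    have DC: "D \<in> components (- ?S)" "C \<in> components (- ?S)" "D \<subseteq> cell" "C \<subseteq> cell"
      using C D unfolding pieces_def by simp_all
    then obtain x y where x: "x \<in> D" and y: "y \<in> C"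
      using in_components_nonempty by blast
    have "x \<notin> path_image \<gamma>" "y \<notin> path_image \<gamma>"
      using x y in_components_subset [OF DC(1)] in_components_subset [OF DC(2)] by auto
    moreover have "connected_component (- T) x y"
      using x y DC(3,4) connected_in_cell by blast
    ultimately have "connected_component (- ?S) x y"
      by (intro separated_connected [OF assms])
    then have "connected_component_set (- ?S) x = connected_component_set (- ?S) y"
      by (rule connected_component_eq [OF _, symmetric, OF CollectI])
    then show ?thesis
      using component_eq_of_mem [OF DC(1) x] component_eq_of_mem [OF DC(2) y] by simp
  qed
  then have "pieces = {D}" using D by blast
  then show ?thesis by simp
qed

end

section \<open>Faces of plane drawings\<close>

lemma finite_edges:
  assumes "finite_simple_graph G"
  shows "finite (edges G)"
proof (rule finite_subset)
  show "edges G \<subseteq> Pow (verts G)"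
    using assms by (auto simp: finite_simple_graph_def)
  show "finite (Pow (verts G))"
    using assms by (simp add: finite_simple_graph_def)
qed

locale plane_graph =
  fixes G :: "'a graph" and p :: "'a \<Rightarrow> complex" and g :: "'a set \<Rightarrow> real \<Rightarrow> complex"
  assumes graph: "finite_simple_graph G" and drawing: "plane_drawing G p g"
begin

abbreviation "V \<equiv> verts G"
abbreviation "E \<equiv> edges G"

lemma finite_V: "finite V"
  using graph by (simp add: finite_simple_graph_def)

lemma edge: "e \<subseteq> V" "card e = 2" if "e \<in> E"
  using graph that by (auto simp: finite_simple_graph_def)

lemma finite_E: "finite E"
  using graph by (rule finite_edges)

lemma inj_p: "inj_on p V"
  using drawing by (simp add: plane_drawing_def)

lemma edge_arc: "arc (g e)" "{pathstart (g e), pathfinish (g e)} = p ` e"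
    "path_image (g e) \<inter> p ` V = p ` e" if "e \<in> E"
  using drawing that by (auto simp: plane_drawing_def)

lemma edges_meet: "path_image (g e) \<inter> path_image (g f) = p ` (e \<inter> f)"
  if "e \<in> E" "f \<in> E" "e \<noteq> f"
  using drawing that by (simp add: plane_drawing_def)

text \<open>All vertices are kept for every \<open>X\<close>, so that a new edge always has both
  ends on the skeleton and is a crosscut of it.\<close>

definition skeleton :: "'a set set \<Rightarrow> complex set" where
  "skeleton X = p ` V \<union> (\<Union>e\<in>X. path_image (g e))"

definition faces :: "'a set set \<Rightarrow> complex set set" where
  "faces X = components (- skeleton X)"

lemma skeleton_insert: "skeleton (insert e X) = skeleton X \<union> path_image (g e)"
  unfolding skeleton_def by auto

lemma skeleton_mono: "X \<subseteq> Y \<Longrightarrow> skeleton X \<subseteq> skeleton Y"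
  unfolding skeleton_def by auto

lemma compact_drawn:
  assumes "A \<subseteq> V" "X \<subseteq> E"
  shows "compact (p ` A \<union> (\<Union>e\<in>X. path_image (g e)))"
proof -
  have "finite A" "finite X" using assms finite_V finite_E finite_subset by auto
  moreover have "compact (path_image (g e))" if "e \<in> X" for e
    using edge_arc(1) [of e] that assms(2) by (auto intro: compact_path_image arc_imp_path)
  ultimately show ?thesis
    by (intro compact_Un compact_UN) (auto intro: finite_imp_compact)
qed

lemma compact_skeleton: "X \<subseteq> E \<Longrightarrow> compact (skeleton X)"
  unfolding skeleton_def by (rule compact_drawn) auto

lemma crosscut_edge:
  assumes "X \<subseteq> E" "e \<in> E" "e \<notin> X"
  shows "crosscut (skeleton X) (g e)"
proof
  have "path_image (g e) \<inter> path_image (g f) \<subseteq> p ` e" if "f \<in> X" for f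
    using edges_meet [of e f] assms that by blast
  then show "path_image (g e) \<inter> skeleton X = {pathstart (g e), pathfinish (g e)}"
    using edge_arc [OF assms(2)] unfolding skeleton_def by blast
qed (use assms compact_skeleton edge_arc in auto)

lemma path_component_edge:
  assumes "e \<in> X" "X \<subseteq> E" "x \<in> p ` e" "y \<in> p ` e"
  shows "path_component (skeleton X) x y"
proof -
  have "e \<in> E" using assms by auto
  note arc = edge_arc [OF this]
  have "path_connected (path_image (g e))"
    using arc(1) arc_imp_path path_connected_path_image by blast
  moreover have "x \<in> path_image (g e)" "y \<in> path_image (g e)"
    using arc(3) assms by auto
  ultimately have "path_component (path_image (g e)) x y"
    by (simp add: path_connected_component)
  moreover have "path_image (g e) \<subseteq> skeleton X"
    using assms unfolding skeleton_def by auto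
  ultimately show ?thesis using path_component_of_subset by blast
qed

lemma ends_drawn:
  assumes "e \<in> E"
  shows "pathstart (g e) \<in> p ` e" "pathfinish (g e) \<in> p ` e"
  using edge_arc(2) [OF assms] by auto

text \<open>Let \<open>R\<close> be the set of vertices that can be reached from the start of
  \<open>e\<close> within the drawing. An edge of \<open>X\<close> has both ends in \<open>R\<close>
  or none, so the parts drawn over \<open>R\<close> and over its complement are disjoint and
  compact.\<close>

lemma joined_or_separated:
  assumes X: "X \<subseteq> E" and e: "e \<in> E" "e \<notin> X"
    and not_joined: "\<not> path_component (skeleton X) (pathstart (g e)) (pathfinish (g e))"
  obtains A B where "skeleton X = A \<union> B" "closed A" "closed B" "A \<inter> B = {}"
    "pathstart (g e) \<in> A" "pathfinish (g e) \<in> B"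
proof -
  define R where "R = {w \<in> V. path_component (skeleton X) (pathstart (g e)) (p w)}"
  define A where "A = p ` R \<union> (\<Union>f\<in>{f \<in> X. f \<inter> R \<noteq> {}}. path_image (g f))"
  define B where "B = p ` (V - R) \<union> (\<Union>f\<in>{f \<in> X. f \<inter> R = {}}. path_image (g f))"
  have R_edge: "f \<subseteq> R" if f: "f \<in> X" "f \<inter> R \<noteq> {}" for f
  proof
    fix y assume y: "y \<in> f"
    obtain x where "x \<in> f" "x \<in> R" using f by auto
    then have "path_component (skeleton X) (pathstart (g e)) (p y)"
      using path_component_edge [OF f(1) X, of "p x" "p y"] y path_component_trans
      unfolding R_def by blast
    then show "y \<in> R" using y f X edge unfolding R_def by blast
  qed
  have "A \<union> B = skeleton X"
    unfolding A_def B_def skeleton_def R_def by blast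
  moreover have "closed A" "closed B"
    unfolding A_def B_def
    by (rule compact_imp_closed, rule compact_drawn; use X in \<open>auto simp: R_def\<close>)+
  moreover have "A \<inter> B = {}"
  proof -
    have vv: "p ` R \<inter> p ` (V - R) = {}"
      using inj_p unfolding R_def inj_on_def by blast
    have ve: "p ` (V - R) \<inter> path_image (g f) = {}" if "f \<in> X" "f \<inter> R \<noteq> {}" for f
      using R_edge [OF that] edge_arc(3) [of f] that X vv by blast
    have ev: "p ` R \<inter> path_image (g f) = {}" if "f \<in> X" "f \<inter> R = {}" for f
    proof -
      have "f \<subseteq> V - R" using that X edge by blast
      then show ?thesis using edge_arc(3) [of f] that X vv unfolding R_def by blast
    qed
    have ee: "path_image (g f) \<inter> path_image (g f') = {}"
      if "f \<in> X" "f \<inter> R \<noteq> {}" "f' \<in> X" "f' \<inter> R = {}" for f f'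
    proof -
      have "f \<noteq> f'" "f \<inter> f' = {}" using R_edge [OF that(1,2)] that by blast+
      then show ?thesis using edges_meet [of f f'] that X by auto
    qed
    have "p ` R \<inter> B = {}"
      unfolding B_def Int_Un_distrib Int_UN_distrib using vv ev by simp
    moreover have "path_image (g f) \<inter> B = {}" if "f \<in> X" "f \<inter> R \<noteq> {}" for f
      unfolding B_def Int_Un_distrib Int_UN_distrib
      using ve [OF that] ee [OF that] by (simp add: Int_commute)
    ultimately show ?thesis unfolding A_def by blast
  qed
  moreover have "pathstart (g e) \<in> A"
  proof -
    obtain u where u: "u \<in> V" "pathstart (g e) = p u"
      using ends_drawn edge e by blast
    then have "u \<in> R"
      unfolding R_def skeleton_def by (simp add: path_component_refl_eq)
    then show ?thesis using u unfolding A_def by auto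
  qed
  moreover have "pathfinish (g e) \<in> B"
  proof -
    obtain u where u: "u \<in> V" "pathfinish (g e) = p u"
      using ends_drawn edge e by blast
    then have "u \<notin> R"
      using not_joined unfolding R_def by auto
    then show ?thesis using u unfolding B_def by auto
  qed
  ultimately show thesis using that by metis
qed

lemma card_pieces:
  assumes "X \<subseteq> E" "e \<in> E" "e \<notin> X"
  shows "card (crosscut.pieces (skeleton X) (g e)) \<in> {1, 2}"
proof (cases "path_component (skeleton X) (pathstart (g e)) (pathfinish (g e))")
  case True
  then show ?thesis using crosscut.joined_card_pieces [OF crosscut_edge [OF assms]] by simp
next
  case False
  then obtain A B where "skeleton X = A \<union> B" "closed A" "closed B" "A \<inter> B = {}"
    "pathstart (g e) \<in> A" "pathfinish (g e) \<in> B"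
    using joined_or_separated [OF assms] by blast
  then show ?thesis using crosscut.separated_card_pieces [OF crosscut_edge [OF assms]] by simp
qed

lemma faces_insert:
  assumes "X \<subseteq> E" "e \<in> E" "e \<notin> X" "finite (faces X)"
  shows "finite (faces (insert e X))"
    and "card (faces (insert e X)) + 1 = card (faces X) + card (crosscut.pieces (skeleton X) (g e))"
proof -
  interpret crosscut "skeleton X" "g e" using crosscut_edge assms by blast
  have fin: "finite pieces"
    using card_pieces [OF assms(1-3)] card.infinite by fastforce
  have eq: "faces (insert e X) = (faces X - {cell}) \<union> pieces"
    unfolding faces_def skeleton_insert by (rule components_Un_arc)
  show "finite (faces (insert e X))" using eq fin assms(4) by simp
  have "cell \<in> faces X" unfolding faces_def by (rule cell_component)
  then have "card (faces X - {cell}) + 1 = card (faces X)"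
    using assms(4) by (metis Suc_eq_plus1 card.remove)
  moreover have "card (faces (insert e X)) = card (faces X - {cell}) + card pieces"
    unfolding eq
    by (rule card_Un_disjoint) (use fin assms(4) pieces_disjoint_components in \<open>auto simp: faces_def\<close>)
  ultimately show "card (faces (insert e X)) + 1 = card (faces X) + card pieces" by simp
qed

section \<open>Euler's inequality, by adding the edges one at a time\<close>

lemma connected_Compl_vertices: "connected (- skeleton {})"
  using finite_V unfolding skeleton_def
  by (intro path_connected_imp_connected path_connected_complement_countable)
    (auto intro: countable_finite)

lemma Compl_skeleton_nonempty: "X \<subseteq> E \<Longrightarrow> - skeleton X \<noteq> {}"
  using compact_skeleton compact_imp_bounded not_bounded_UNIV by (metis Compl_empty_eq double_complement)

text \<open>The labels \<open>h\<close> count the connected components from above: equal labels mean that the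
  vertices are joined in the drawing.\<close>

lemma euler_labels:
  assumes "X \<subseteq> E"
  shows "finite (faces X) \<and> (\<exists>h :: 'a \<Rightarrow> 'a.
    (\<forall>u\<in>V. \<forall>v\<in>V. h u = h v \<longrightarrow> path_component (skeleton X) (p u) (p v)) \<and>
    card X + 1 + card (h ` V) \<le> card (faces X) + card V)"
proof -
  have "finite X" using assms finite_E finite_subset by blast
  then show ?thesis using assms
  proof induction
    case empty
    have "faces {} = {- skeleton {}}"
      unfolding faces_def
      using connected_Compl_vertices Compl_skeleton_nonempty [of "{}"]
      by (auto simp: connected_eq_connected_components_eq components_eq_sing_iff)
    moreover have "path_component (skeleton {}) (p u) (p u)" if "u \<in> V" for u
      using that by (simp add: skeleton_def path_component_refl_eq)
    \<comment> \<open>Without edges there is one face and each vertex is its own label, so both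
      sides of the count agree.\<close>
    ultimately show ?case by (auto intro!: exI [of _ "\<lambda>x. x"])
  next
    case (insert e X)
    then have X: "X \<subseteq> E" and e: "e \<in> E" "e \<notin> X" by auto
    obtain h :: "'a \<Rightarrow> 'a" where fin: "finite (faces X)"
      and h: "\<And>u v. u \<in> V \<Longrightarrow> v \<in> V \<Longrightarrow> h u = h v \<Longrightarrow> path_component (skeleton X) (p u) (p v)"
      and count: "card X + 1 + card (h ` V) \<le> card (faces X) + card V"
      using insert.IH [OF X] by auto
    note new = faces_insert [OF X e fin]
    have mono: "path_component (skeleton (insert e X)) x y"
      if "path_component (skeleton X) x y" for x y
      using that skeleton_mono [of X "insert e X"] path_component_of_subset by blast
    show ?case
    proof (cases "path_component (skeleton X) (pathstart (g e)) (pathfinish (g e))")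
      case True
      then have "card (crosscut.pieces (skeleton X) (g e)) = 2"
        using crosscut.joined_card_pieces crosscut_edge X e by blast
      \<comment> \<open>The new edge is paid for by a new face; the labels stay.\<close>
      then have "card (insert e X) + 1 + card (h ` V) \<le> card (faces (insert e X)) + card V"
        using new(2) count e insert.hyps by simp
      then show ?thesis using new(1) h mono by blast
    next
      case False
      obtain u v where uv: "u \<in> V" "v \<in> V" "pathstart (g e) = p u" "pathfinish (g e) = p v"
        using ends_drawn edge e by blast
      have ne: "h u \<noteq> h v" using False h uv by metis
      \<comment> \<open>The new edge is paid for by the label of \<open>v\<close>, which is merged
        into that of \<open>u\<close>; the number of faces does not drop.\<close>
      define h' where "h' x = (if h x = h v then h u else h x)" for x
      have uv_joined: "path_component (skeleton (insert e X)) (p u) (p v)"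
        using path_component_edge [of e "insert e X"] ends_drawn [of e] uv e X by force
      have "path_component (skeleton (insert e X)) (p x) (p y)"
        if xy: "x \<in> V" "y \<in> V" "h' x = h' y" for x y
      proof -
        consider "h x = h y" | "h x = h v" "h y = h u" | "h x = h u" "h y = h v"
          using xy unfolding h'_def by (metis (full_types))
        then show ?thesis
        proof cases
          case 1 then show ?thesis using h mono xy by blast
        next
          case 2
          then have "path_component (skeleton (insert e X)) (p x) (p v)"
            "path_component (skeleton (insert e X)) (p u) (p y)"
            using h mono xy uv by metis+
          then show ?thesis using uv_joined path_component_trans path_component_sym by metis
        next
          case 3
          then have "path_component (skeleton (insert e X)) (p x) (p u)"
            "path_component (skeleton (insert e X)) (p v) (p y)"
            using h mono xy uv by metis+
          then show ?thesis using uv_joined path_component_trans by metis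
        qed
      qed
      moreover have "card (h' ` V) + 1 \<le> card (h ` V)"
      proof -
        have "h' ` V \<subseteq> h ` V - {h v}"
          using uv ne unfolding h'_def by auto
        then have "card (h' ` V) \<le> card (h ` V - {h v})"
          using finite_V by (intro card_mono) auto
        moreover have "card (h ` V - {h v}) + 1 = card (h ` V)"
          using uv finite_V by (metis Suc_eq_plus1 card.remove finite_imageI imageI)
        ultimately show ?thesis by simp
      qed
      moreover have "card (faces X) \<le> card (faces (insert e X))"
        using new(2) card_pieces [OF X e] by auto
      ultimately have "(\<forall>x\<in>V. \<forall>y\<in>V. h' x = h' y \<longrightarrow> path_component (skeleton (insert e X)) (p x) (p y)) \<and>
        card (insert e X) + 1 + card (h' ` V) \<le> card (faces (insert e X)) + card V"
        using count e insert.hyps by auto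
      then show ?thesis using new(1) by blast
    qed
  qed
qed

lemma finite_faces: "X \<subseteq> E \<Longrightarrow> finite (faces X)"
  using euler_labels by blast

lemma euler:
  assumes "V \<noteq> {}"
  shows "card E + 2 \<le> card (faces E) + card V"
proof -
  obtain h :: "'a \<Rightarrow> 'a" where "card E + 1 + card (h ` V) \<le> card (faces E) + card V"
    using euler_labels [OF subset_refl] by blast
  moreover have "1 \<le> card (h ` V)"
    using assms finite_V by (simp add: Suc_le_eq card_gt_0_iff)
  ultimately show ?thesis by simp
qed

section \<open>Sides of edges and boundaries of faces\<close>

text \<open>The faces along \<open>e\<close> are obtained by drawing \<open>e\<close> last. There is
  only one of them if the other edges do not join the ends of \<open>e\<close>.\<close>

definition sides :: "'a set \<Rightarrow> complex set set" where
  "sides e = crosscut.pieces (skeleton (E - {e})) (g e)"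

lemma sides:
  assumes "e \<in> E"
  shows "sides e \<subseteq> faces E" "card (sides e) \<in> {1, 2}"
proof -
  interpret crosscut "skeleton (E - {e})" "g e"
    using crosscut_edge assms by blast
  have "insert e (E - {e}) = E" using assms by auto
  then have "skeleton E = skeleton (E - {e}) \<union> path_image (g e)"
    using skeleton_insert by metis
  then show "sides e \<subseteq> faces E"
    unfolding sides_def faces_def using pieces_subset by simp
  show "card (sides e) \<in> {1, 2}"
    unfolding sides_def using card_pieces assms by blast
qed

definition boundary :: "complex set \<Rightarrow> 'a set set" where
  "boundary f = {e \<in> E. f \<in> sides e}"

text \<open>A frontier point inside an edge \<open>e\<close> lies in the cell that \<open>e\<close>
  divides. The cell is open, so the face meets it and is one of its pieces, that is, a side of
  \<open>e\<close>.\<close>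

lemma frontier_face:
  assumes f: "f \<in> faces E"
  shows "frontier f \<subseteq> skeleton (boundary f)"
proof
  fix x assume x: "x \<in> frontier f"
  have "frontier f \<subseteq> skeleton E"
    using f compact_skeleton [of E] frontier_of_components_closed_complement compact_imp_closed
    unfolding faces_def by blast
  then have "x \<in> skeleton E" using x by blast
  then consider "x \<in> p ` V" | e where "e \<in> E" "x \<in> path_image (g e)" "x \<notin> p ` V"
    unfolding skeleton_def by blast
  then show "x \<in> skeleton (boundary f)"
  proof cases
    case 1 then show ?thesis unfolding skeleton_def by blast
  next
    case 2
    interpret crosscut "skeleton (E - {e})" "g e"
      using crosscut_edge 2 by blast
    have E: "skeleton E = skeleton (E - {e}) \<union> path_image (g e)"
      using skeleton_insert [of e "E - {e}"] 2 by (simp add: insert_absorb)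
    have "{pathstart (g e), pathfinish (g e)} \<subseteq> p ` V"
      using edge_arc(2) edge 2 by blast
    then have "x \<notin> skeleton (E - {e})" using meet 2 by blast
    then have "x \<in> cell" using open_arc_subset_cell 2 by blast
    moreover have "x \<in> closure f" using x unfolding frontier_def by blast
    ultimately have "f \<inter> cell \<noteq> {}"
      using open_cell by (metis Int_commute closure_iff_nhds_not_empty disjoint_iff order_refl)
    then have "f \<in> sides e"
      using piece_iff f unfolding sides_def faces_def E by blast
    then show ?thesis using 2 unfolding boundary_def skeleton_def by blast
  qed
qed

text \<open>The midpoint of an edge off the boundary lies neither on the skeleton of the boundary
  nor in \<open>f\<close>. So \<open>f\<close> is a nonempty proper part of the complement of that
  skeleton, while its frontier is contained in the skeleton.\<close>

lemma boundary_separates: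
  assumes f: "f \<in> faces E" and "boundary f \<noteq> E"
  shows "\<not> connected (- skeleton (boundary f))"
proof
  assume con: "connected (- skeleton (boundary f))"
  obtain e where e: "e \<in> E" "e \<notin> boundary f"
    using assms(2) unfolding boundary_def by blast
  have sub: "boundary f \<subseteq> E" unfolding boundary_def by blast
  interpret crosscut "skeleton (boundary f)" "g e"
    using crosscut_edge sub e by blast
  have f': "f \<noteq> {}" "f \<subseteq> - skeleton E"
    using f in_components_nonempty in_components_subset unfolding faces_def by blast+
  have "g e (1/2) \<in> skeleton E"
    using midpoint e unfolding skeleton_def by blast
  then have "- skeleton (boundary f) - f \<noteq> {}"
    using midpoint f' by blast
  moreover have "- skeleton (boundary f) \<inter> f \<noteq> {}"
    using f' skeleton_mono [OF sub] by blast
  ultimately show False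
    using connected_Int_frontier [OF con] frontier_face [OF f] by blast
qed

section \<open>Small edge sets that do not separate the plane\<close>

text \<open>Before \<open>e\<close> is drawn, the leaf \<open>v\<close> is an isolated point of the
  skeleton, so \<open>e\<close> joins the closed set \<open>{p v}\<close> to the closed
  rest.\<close>

lemma connected_Compl_leaf:
  assumes X: "X \<subseteq> E" and e: "e \<in> E" "e \<notin> X" and v: "v \<in> e" "v \<notin> \<Union>X"
    and con: "connected (- skeleton X)"
  shows "connected (- skeleton (insert e X))"
proof -
  interpret crosscut "skeleton X" "g e" using crosscut_edge X e by blast
  define A where "A = p ` (V - {v}) \<union> (\<Union>f\<in>X. path_image (g f))"
  have vV: "v \<in> V" using v e edge by blast
  have pv: "p v \<notin> A"
  proof -
    have "p v \<notin> p ` (V - {v})" using inj_p vV unfolding inj_on_def by blast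
    moreover have "p v \<notin> path_image (g f)" if "f \<in> X" for f
    proof
      assume "p v \<in> path_image (g f)"
      then have "p v \<in> p ` f" using edge_arc(3) [of f] that X vV by blast
      moreover have "f \<subseteq> V - {v}" using that X v edge by blast
      ultimately show False using \<open>p v \<notin> p ` (V - {v})\<close> by blast
    qed
    ultimately show ?thesis unfolding A_def by blast
  qed
  have sep: "skeleton X = A \<union> {p v}" "closed A" "closed {p v}" "A \<inter> {p v} = {}"
    using vV pv compact_imp_closed [OF compact_drawn [of "V - {v}" X]] X
    unfolding A_def skeleton_def by auto
  \<comment> \<open>The arc \<open>g e\<close> may start or finish at \<open>p v\<close>, so the
    split is needed in both orders.\<close>
  then have sep': "skeleton X = {p v} \<union> A" "closed {p v}" "closed A" "{p v} \<inter> A = {}"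
    by auto
  have ends: "pathstart (g e) \<in> skeleton X" "pathfinish (g e) \<in> skeleton X"
    using meet by blast+
  have "p v = pathstart (g e) \<or> p v = pathfinish (g e)"
    using edge_arc(2) [OF e(1)] v by blast
  then have "connected_component (- skeleton (insert e X)) x y"
    if "x \<in> - skeleton (insert e X)" "y \<in> - skeleton (insert e X)" for x y
  proof -
    have "connected_component (- skeleton X) x y" "x \<notin> path_image (g e)" "y \<notin> path_image (g e)"
      using con that unfolding skeleton_insert connected_component_def by blast+
    moreover have "(pathstart (g e) \<in> A \<and> pathfinish (g e) \<in> {p v}) \<or>
        (pathstart (g e) \<in> {p v} \<and> pathfinish (g e) \<in> A)"
      using \<open>p v = pathstart (g e) \<or> p v = pathfinish (g e)\<close> ends ends_distinct
      unfolding sep(1) by (metis Un_iff singletonD singletonI)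
    ultimately show ?thesis
      unfolding skeleton_insert
      using separated_connected [OF sep] separated_connected [OF sep'] by blast
  qed
  then show ?thesis by (simp add: connected_iff_connected_component)
qed

end

definition triangle :: "'a set set \<Rightarrow> bool" where
  "triangle X \<longleftrightarrow> (\<exists>x y z. x \<noteq> y \<and> y \<noteq> z \<and> x \<noteq> z \<and> X = {{x, y}, {y, z}, {x, z}})"

lemma card_triangle:
  assumes "triangle X"
  shows "card X = 3"
proof -
  obtain x y z where xyz: "x \<noteq> y" "y \<noteq> z" "x \<noteq> z" "X = {{x, y}, {y, z}, {x, z}}"
    using assms unfolding triangle_def by blast
  then have "{x, y} \<noteq> {y, z}" "{x, y} \<noteq> {x, z}" "{y, z} \<noteq> {x, z}"
    by (auto simp: doubleton_eq_iff)
  then show ?thesis using xyz(4) by simp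
qed

text \<open>Each end of an edge \<open>ab\<close> lies on a further edge, and these two differ
  because the graph is simple, so \<open>X\<close> is exhausted. The far end of the one can then
  only lie on the other. Hence up to three edges that form no triangle have a leaf to peel
  off.\<close>

lemma leafless_triangle:
  assumes "finite X" "X \<noteq> {}" "card X \<le> 3" "\<And>e. e \<in> X \<Longrightarrow> card e = 2"
    and leafless: "\<And>e v. e \<in> X \<Longrightarrow> v \<in> e \<Longrightarrow> \<exists>f\<in>X. f \<noteq> e \<and> v \<in> f"
  shows "triangle X"
proof -
  obtain e where e: "e \<in> X" using assms by blast
  obtain a b where ab: "e = {a, b}" "a \<noteq> b"
    using assms(4) [OF e] by (auto simp: card_2_iff)
  obtain f where f: "f \<in> X" "f \<noteq> e" "a \<in> f" using leafless [OF e] ab by blast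
  obtain h where h: "h \<in> X" "h \<noteq> e" "b \<in> h" using leafless [OF e] ab by blast
  obtain c where c: "f = {a, c}" "a \<noteq> c"
    using assms(4) [OF f(1)] f(3) by (auto simp: card_2_iff)
  have "c \<noteq> b" using f(2) c ab by auto
  then have "f \<noteq> h" using c h(3) ab by auto
  then have "card {e, f, h} = 3" using f h by simp
  then have X: "X = {e, f, h}"
    using assms(1,3) e f h by (intro card_seteq [symmetric]) auto
  obtain k where "k \<in> X" "k \<noteq> f" "c \<in> k" using leafless [OF f(1)] c by blast
  then have "c \<in> h" using X ab c \<open>c \<noteq> b\<close> by auto
  then have "h = {b, c}"
    using assms(4) [OF h(1)] h(3) \<open>c \<noteq> b\<close> by (auto simp: card_2_iff)
  then show ?thesis
    unfolding triangle_def X ab c using ab c \<open>c \<noteq> b\<close>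
    by (intro exI [of _ a] exI [of _ b] exI [of _ c]) auto
qed

context plane_graph
begin

text \<open>Leaves are peeled off until only the vertices remain. After the first removal at most
  two edges are left, so no triangle can appear on the way.\<close>

lemma connected_Compl_small:
  assumes "X \<subseteq> E" "card X \<le> 3" "\<not> triangle X"
  shows "connected (- skeleton X)"
  using assms
proof (induction "card X" arbitrary: X)
  case 0
  then have "X = {}" using finite_E finite_subset by fastforce
  then show ?case using connected_Compl_vertices by simp
next
  case (Suc n)
  have fin: "finite X" using Suc.prems finite_E finite_subset by blast
  have "X \<noteq> {}" using Suc.hyps by auto
  moreover have "card e = 2" if "e \<in> X" for e using that Suc.prems(1) edge(2) by blast
  ultimately obtain e v where e: "e \<in> X" "v \<in> e" "\<And>f. f \<in> X \<Longrightarrow> f \<noteq> e \<Longrightarrow> v \<notin> f"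
    using leafless_triangle [OF fin] Suc.prems(2,3) by metis
  have card: "card (X - {e}) = n" using fin e Suc.hyps by simp
  have "\<not> triangle (X - {e})"
  proof
    assume "triangle (X - {e})"
    then have "card (X - {e}) = 3" by (rule card_triangle)
    then show False using card Suc.hyps(2) Suc.prems(2) by linarith
  qed
  then have "connected (- skeleton (X - {e}))"
    using Suc.prems(1,2) Suc.hyps(2) card by (intro Suc.hyps(1)) auto
  then have "connected (- skeleton (insert e (X - {e})))"
    using Suc.prems(1) e by (intro connected_Compl_leaf [of _ _ v]) auto
  then show ?case using e by (simp add: insert_absorb)
qed

text \<open>Four edges in \<open>E\<close> ensure that a boundary of at most three edges is a proper
  subset of \<open>E\<close>. It then separates the plane, which leaves only the triangle.\<close>

lemma card_boundary:
  assumes "f \<in> faces E" "4 \<le> card E"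
  shows "4 \<le> card (boundary f) \<or> triangle (boundary f)"
proof (rule ccontr)
  assume neg: "\<not> ?thesis"
  then have "boundary f \<noteq> E" using assms(2) by auto
  moreover have "boundary f \<subseteq> E" unfolding boundary_def by auto
  ultimately show False
    using boundary_separates assms(1) connected_Compl_small neg by fastforce
qed

text \<open>The weight \<open>w e f\<close> counts the sides of \<open>e\<close> that lie in \<open>f\<close>, so that
  \<open>\<Sum>e\<in>edges G. w e f\<close> is the length of the face \<open>f\<close>.\<close>

lemma face_weights:
  assumes "4 \<le> card E"
  obtains F :: "complex set set" and w :: "'a set \<Rightarrow> complex set \<Rightarrow> nat" where
    "finite F" "card E + 2 \<le> card F + card V" "\<And>e. e \<in> E \<Longrightarrow> (\<Sum>f\<in>F. w e f) = 2"
    "\<And>f. f \<in> F \<Longrightarrow> 4 \<le> card {e \<in> E. w e f \<noteq> 0} \<or> triangle {e \<in> E. w e f \<noteq> 0}"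
proof
  define w :: "'a set \<Rightarrow> complex set \<Rightarrow> nat"
    where "w e f = (if f \<in> sides e then 2 div card (sides e) else 0)" for e f
  show "finite (faces E)" by (simp add: finite_faces)
  have "E \<noteq> {}" using assms by auto
  then have "V \<noteq> {}" using edge by fastforce
  then show "card E + 2 \<le> card (faces E) + card V" by (rule euler)
  show "(\<Sum>f\<in>faces E. w e f) = 2" if e: "e \<in> E" for e
  proof -
    have "(\<Sum>f\<in>faces E. w e f) = (\<Sum>f\<in>sides e. w e f)"
      using sides(1) [OF e] finite_faces [of E]
      by (intro sum.mono_neutral_right) (auto simp: w_def)
    also have "\<dots> = card (sides e) * (2 div card (sides e))"
      by (simp add: w_def)
    also have "\<dots> = 2" using sides(2) [OF e] by auto
    finally show ?thesis .
  qed
  show "4 \<le> card {e \<in> E. w e f \<noteq> 0} \<or> triangle {e \<in> E. w e f \<noteq> 0}" if "f \<in> faces E" for f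
  proof -
    have "{e \<in> E. w e f \<noteq> 0} = boundary f"
      unfolding w_def boundary_def
      by (rule Collect_cong, rule conj_cong) (auto dest!: sides(2))
    then show ?thesis using card_boundary assms that by simp
  qed
qed

end

section \<open>Light edges\<close>

lemma sum_incident:
  fixes h :: "'a set \<Rightarrow> real"
  assumes "finite A" "finite X"
  shows "(\<Sum>x\<in>A. \<Sum>e | e \<in> X \<and> x \<in> e. h e) = (\<Sum>e\<in>X. real (card (A \<inter> e)) * h e)"
proof -
  have "(\<Sum>x\<in>A. \<Sum>e | e \<in> X \<and> x \<in> e. h e) = (\<Sum>e\<in>X. \<Sum>x | x \<in> A \<and> x \<in> e. h e)"
    by (rule sum.swap_restrict) (use assms in auto)
  also have "\<dots> = (\<Sum>e\<in>X. real (card (A \<inter> e)) * h e)"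
    by (simp add: Int_def)
  finally show ?thesis .
qed

lemma other_end:
  assumes "card e = 2" "v \<in> e"
  obtains u where "e = {v, u}" "u \<noteq> v"
proof -
  obtain a b where "e = {a, b}" "a \<noteq> b" using assms(1) by (auto simp: card_2_iff)
  then show thesis using assms(2) that [of a] that [of b] by auto
qed

lemma triangle_third_vertex:
  assumes "triangle X" "{x, l} \<in> X" "x \<noteq> l"
  obtains z where "z \<noteq> x" "z \<noteq> l" "X = {{x, l}, {x, z}, {l, z}}"
proof -
  obtain a b c where abc: "a \<noteq> b" "b \<noteq> c" "a \<noteq> c" "X = {{a, b}, {b, c}, {a, c}}"
    using assms(1) unfolding triangle_def by blast
  then consider "{x, l} = {a, b}" | "{x, l} = {b, c}" | "{x, l} = {a, c}"
    using assms(2) by blast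
  then show thesis
  proof cases
    case 1
    then show ?thesis using abc by (intro that [of c]) (auto simp: doubleton_eq_iff)
  next
    case 2
    then show ?thesis using abc by (intro that [of a]) (auto simp: doubleton_eq_iff)
  next
    case 3
    then show ?thesis using abc by (intro that [of b]) (auto simp: doubleton_eq_iff)
  qed
qed

section \<open>The discharging argument\<close>

text \<open>A counterexample to Kotzig's theorem with the topology stripped off: faces are abstract
  objects, known only through the number \<open>w e f\<close> of sides that \<open>e\<close> has in
  \<open>f\<close>. The locale is set up to be refuted.\<close>

locale discharging =
  fixes G :: "'a graph" and F :: "'f set" and w :: "'a set \<Rightarrow> 'f \<Rightarrow> nat"
  assumes graph: "finite_simple_graph G"
    and min_degree: "\<And>v. v \<in> verts G \<Longrightarrow> 3 \<le> degree G v"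
    and heavy_neighbour: "\<And>u v. {u, v} \<in> edges G \<Longrightarrow> degree G u \<le> 5 \<Longrightarrow> 14 \<le> degree G u + degree G v"
    and finite_F: "finite F"
    and euler: "card (edges G) + 2 \<le> card F + card (verts G)"
    and two_sides: "\<And>e. e \<in> edges G \<Longrightarrow> (\<Sum>f\<in>F. w e f) = 2"
    and face: "\<And>f. f \<in> F \<Longrightarrow>
      4 \<le> card {e \<in> edges G. w e f \<noteq> 0} \<or> triangle {e \<in> edges G. w e f \<noteq> 0}"
begin

abbreviation "V \<equiv> verts G"
abbreviation "E \<equiv> edges G"

text \<open>The threshold marks the vertices whose initial charge, degree minus 6, is
  negative.\<close>

definition "L = {v \<in> V. degree G v \<le> 5}"
definition "H = V - L"
definition "light_at x = {e \<in> E. e \<inter> L \<noteq> {} \<and> x \<in> e}"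
definition "heavy_at x = {e \<in> E. e \<inter> L = {} \<and> x \<in> e}"
text \<open>At a triangle no heavy vertex \<open>x\<close> has more light than heavy edge sides.  A longer face \<open>f\<close>
  can afford to pay half of \<open>excess x f\<close> to each of its heavy vertices \<open>x\<close>.\<close>

definition "len f = (\<Sum>e\<in>E. real (w e f))"
definition "excess x f =
  max 0 ((\<Sum>e\<in>light_at x. real (w e f)) - (\<Sum>e\<in>heavy_at x. real (w e f)))"

lemma finite_V: "finite V" and edge: "e \<in> E \<Longrightarrow> e \<subseteq> V" "e \<in> E \<Longrightarrow> card e = 2"
  using graph by (auto simp: finite_simple_graph_def)

lemma finite_E: "finite E"
  using graph by (rule finite_edges)

lemma finite_LH: "finite L" "finite H" "L \<inter> H = {}" "L \<union> H = V"
  using finite_V by (auto simp: L_def H_def)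

text \<open>Two degrees of at most 5 cannot add up to 14, so no edge has both ends in
  \<open>L\<close>.\<close>

lemma light_edge:
  assumes "e \<in> E" "e \<inter> L \<noteq> {}"
  obtains l x where "e = {l, x}" "l \<noteq> x" "l \<in> L" "x \<in> H" "14 \<le> degree G l + degree G x"
proof -
  obtain l where l: "l \<in> e" "l \<in> L" using assms by auto
  then obtain x where x: "e = {l, x}" "l \<noteq> x"
    using edge(2) [OF assms(1)] by (auto simp: card_2_iff)
  have "14 \<le> degree G l + degree G x"
    using heavy_neighbour [of l x] assms(1) x l by (auto simp: L_def)
  moreover from this have "x \<in> H"
    using x l edge(1) [OF assms(1)] by (auto simp: H_def L_def)
  ultimately show thesis using that x l by blast
qed

lemma light_edge_card:
  assumes "e \<in> E" "e \<inter> L \<noteq> {}"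
  shows "card (H \<inter> e) = 1"
proof -
  obtain l x where "e = {l, x}" "l \<noteq> x" "l \<in> L" "x \<in> H" using light_edge [OF assms] by metis
  then have "H \<inter> e = {x}" using finite_LH(3) by blast
  then show ?thesis by simp
qed

lemma sum_degree: "(\<Sum>v\<in>V. real (degree G v)) = 2 * real (card E)"
proof -
  have "(\<Sum>v\<in>V. real (degree G v)) = (\<Sum>v\<in>V. \<Sum>e | e \<in> E \<and> v \<in> e. 1)"
    by (simp add: degree_def)
  also have "\<dots> = (\<Sum>e\<in>E. real (card (V \<inter> e)) * 1)"
    by (rule sum_incident [OF finite_V finite_E])
  also have "\<dots> = (\<Sum>e\<in>E. 2)"
    using edge by (intro sum.cong) (auto simp: Int_absorb1)
  finally show ?thesis by simp
qed

lemma sum_sides: "X \<subseteq> E \<Longrightarrow> (\<Sum>f\<in>F. \<Sum>e\<in>X. real (w e f)) = 2 * real (card X)"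
proof -
  assume X: "X \<subseteq> E"
  have "(\<Sum>f\<in>F. \<Sum>e\<in>X. real (w e f)) = (\<Sum>e\<in>X. \<Sum>f\<in>F. real (w e f))"
    by (rule sum.swap)
  also have "\<dots> = (\<Sum>e\<in>X. 2)"
    using two_sides X by (intro sum.cong) (auto simp flip: of_nat_sum)
  finally show ?thesis by simp
qed

text \<open>Both degrees and face lengths sum to twice the number of edges, so the left side is six
  times |E| - |V| - |F|, which Euler's inequality bounds by -2.\<close>

lemma total_charge: "(\<Sum>v\<in>V. real (degree G v) - 6) + (\<Sum>f\<in>F. 2 * len f - 6) \<le> -12"
proof -
  have "(\<Sum>f\<in>F. len f) = 2 * real (card E)"
    unfolding len_def using sum_sides by blast
  then have "(\<Sum>f\<in>F. 2 * len f - 6) = 4 * real (card E) - 6 * real (card F)"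
    by (simp add: sum_subtractf flip: sum_distrib_left)
  moreover have "(\<Sum>v\<in>V. real (degree G v) - 6) = 2 * real (card E) - 6 * real (card V)"
    by (simp add: sum_subtractf sum_degree)
  moreover have "real (card E) + 2 \<le> real (card F) + real (card V)"
    using euler by linarith
  ultimately show ?thesis by simp
qed

text \<open>If a heavy \<open>x\<close> has a light edge to \<open>l\<close> in the triangle, the
  third vertex \<open>z\<close> is adjacent to \<open>l\<close> and therefore heavy. So the edge
  from \<open>x\<close> to \<open>z\<close> is heavy and balances the only light one.\<close>

lemma triangle_balanced:
  assumes B: "triangle B" "B \<subseteq> E"
  shows "card {e \<in> B. e \<inter> L \<noteq> {} \<and> x \<in> e} \<le> card {e \<in> B. e \<inter> L = {} \<and> x \<in> e} \<or> x \<notin> H"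
proof (cases "x \<in> H \<and> {e \<in> B. e \<inter> L \<noteq> {} \<and> x \<in> e} \<noteq> {}")
  case True
  then obtain e where e: "e \<in> B" "e \<inter> L \<noteq> {}" "x \<in> e" by auto
  obtain l y where ly: "e = {l, y}" "l \<noteq> y" "l \<in> L" "y \<in> H"
    using light_edge [of e] e B by (metis subsetD)
  then have "y = x" using True e finite_LH(3) by auto
  then have xl: "{x, l} \<in> B" "x \<noteq> l" using ly e by (auto simp: insert_commute)
  obtain z where z: "z \<noteq> x" "z \<noteq> l" "B = {{x, l}, {x, z}, {l, z}}"
    using triangle_third_vertex [OF B(1) xl] by metis
  have "z \<notin> L"
  proof
    assume "z \<in> L"
    then have "H \<inter> {l, z} = {}" using ly(3) finite_LH(3) by auto
    then show False using light_edge_card [of "{l, z}"] z(3) ly(3) B(2) by auto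
  qed
  moreover have "x \<notin> L" using True finite_LH by auto
  ultimately have light: "{e \<in> B. e \<inter> L \<noteq> {} \<and> x \<in> e} = {{x, l}}"
    and heavy: "{x, z} \<in> {e \<in> B. e \<inter> L = {} \<and> x \<in> e}"
    using z ly xl by auto
  have "finite {e \<in> B. e \<inter> L = {} \<and> x \<in> e}" using z(3) by simp
  then have "0 < card {e \<in> B. e \<inter> L = {} \<and> x \<in> e}"
    using heavy card_gt_0_iff by blast
  then show ?thesis unfolding light by simp
next
  case False
  then consider "x \<notin> H" | "{e \<in> B. e \<inter> L \<noteq> {} \<and> x \<in> e} = {}" by blast
  then show ?thesis by cases (simp_all only: card.empty le0 simp_thms)
qed

text \<open>A light edge has exactly one heavy end, so the total excess is at most
  \<open>len f\<close>, and this is at most \<open>2 * (2 * len f - 6)\<close> as soon as the length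
  is at least 4. A shorter face is a triangle with all weights 1, where every excess
  vanishes.\<close>

lemma excess_le_face:
  assumes f: "f \<in> F"
  shows "(\<Sum>x\<in>H. excess x f) \<le> 2 * (2 * len f - 6)"
proof -
  define B where "B = {e \<in> E. w e f \<noteq> 0}"
  have B: "finite B" "B \<subseteq> E" using finite_E by (auto simp: B_def)
  have len_B: "len f = (\<Sum>e\<in>B. real (w e f))"
    unfolding len_def B_def using finite_E by (intro sum.mono_neutral_right) auto
  have len_ge: "real (card B) \<le> len f"
  proof -
    have "(\<Sum>e\<in>B. 1) \<le> (\<Sum>e\<in>B. real (w e f))"
      by (rule sum_mono) (auto simp: B_def)
    then show ?thesis unfolding len_B by simp
  qed
  show ?thesis
  proof (cases "4 \<le> len f")
    case True
    have "(\<Sum>x\<in>H. excess x f) \<le> (\<Sum>x\<in>H. \<Sum>e\<in>light_at x. real (w e f))"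
      unfolding excess_def by (intro sum_mono) (simp add: sum_nonneg)
    also have "\<dots> = (\<Sum>x\<in>H. \<Sum>e | e \<in> {e \<in> E. e \<inter> L \<noteq> {}} \<and> x \<in> e. real (w e f))"
      by (simp add: light_at_def conj_assoc)
    also have "\<dots> = (\<Sum>e | e \<in> E \<and> e \<inter> L \<noteq> {}. real (card (H \<inter> e)) * real (w e f))"
      using sum_incident [OF finite_LH(2), of "{e \<in> E. e \<inter> L \<noteq> {}}"] finite_E by simp
    also have "\<dots> = (\<Sum>e | e \<in> E \<and> e \<inter> L \<noteq> {}. real (w e f))"
      using light_edge_card by (intro sum.cong) auto
    also have "\<dots> \<le> len f"
      unfolding len_def using finite_E by (intro sum_mono2) auto
    finally show ?thesis using True by simp
  next
    case False
    then have tri: "triangle B" using face [OF f] len_ge unfolding B_def by fastforce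
    then have "card B = 3" by (rule card_triangle)
    have len3: "len f = 3"
    proof -
      \<comment> \<open>The real number \<open>len f\<close> lies in the interval from 3 to below 4;
        being a natural number, it is 3.\<close>
      define n where "n = (\<Sum>e\<in>B. w e f)"
      have "len f = real n" unfolding len_B n_def by simp
      then show ?thesis using len_ge False \<open>card B = 3\<close> by simp
    qed
    have w1: "w e f = 1" if "e \<in> B" for e
    proof (rule ccontr)
      assume "w e f \<noteq> 1"
      then have "(\<Sum>e\<in>B. 1) < (\<Sum>e\<in>B. real (w e f))"
        using that B(1) by (intro sum_strict_mono_ex1) (auto simp: B_def intro!: bexI [of _ e])
      then show False using len3 \<open>card B = 3\<close> unfolding len_B by simp
    qed
    have "excess x f = 0" if x: "x \<in> H" for x
    proof -
      have count: "(\<Sum>e | e \<in> E \<and> P e. real (w e f)) = real (card {e \<in> B. P e})" for P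
      proof -
        have "(\<Sum>e | e \<in> E \<and> P e. real (w e f)) = (\<Sum>e | e \<in> B \<and> P e. real (w e f))"
          using finite_E by (intro sum.mono_neutral_right) (auto simp: B_def)
        also have "\<dots> = (\<Sum>e | e \<in> B \<and> P e. 1)" using w1 by (intro sum.cong) auto
        finally show ?thesis by simp
      qed
      show ?thesis
        using triangle_balanced [OF tri B(2), of x] x
        unfolding excess_def light_at_def heavy_at_def count by simp
    qed
    then show ?thesis using len3 by simp
  qed
qed

text \<open>Every edge has two sides in all, so the signed differences inside \<open>excess\<close>
  sum to twice the difference of the edge counts. The \<open>max\<close> with 0 can only increase
  the sum.\<close>

lemma excess_ge:
  "0 \<le> (\<Sum>f\<in>F. excess x f)"
  "2 * real (card (light_at x)) - 2 * real (card (heavy_at x)) \<le> (\<Sum>f\<in>F. excess x f)"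
proof -
  show "0 \<le> (\<Sum>f\<in>F. excess x f)" by (intro sum_nonneg) (simp add: excess_def)
  have "light_at x \<subseteq> E" "heavy_at x \<subseteq> E" by (auto simp: light_at_def heavy_at_def)
  then have "2 * real (card (light_at x)) - 2 * real (card (heavy_at x)) =
      (\<Sum>f\<in>F. (\<Sum>e\<in>light_at x. real (w e f)) - (\<Sum>e\<in>heavy_at x. real (w e f)))"
    by (simp add: sum_subtractf sum_sides)
  also have "\<dots> \<le> (\<Sum>f\<in>F. excess x f)"
    by (intro sum_mono) (simp add: excess_def)
  finally show "2 * real (card (light_at x)) - 2 * real (card (heavy_at x)) \<le> (\<Sum>f\<in>F. excess x f)" .
qed

text \<open>A light vertex \<open>l\<close> of degree \<open>d\<close> lacks charge \<open>6 - d\<close> and asks for equal parts of it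
  along its \<open>d\<close> edges.\<close>

definition "demand e = (\<Sum>l\<in>L \<inter> e. (6 - real (degree G l)) / real (degree G l))"

lemma demand_eq:
  assumes "l \<in> L" "x \<in> H"
  shows "demand {l, x} = (6 - real (degree G l)) / real (degree G l)"
proof -
  have "L \<inter> {l, x} = {l}" using assms finite_LH(3) by auto
  then show ?thesis by (simp add: demand_def)
qed

lemma light_degree_cases: "l \<in> L \<Longrightarrow> degree G l = 3 \<or> degree G l = 4 \<or> degree G l = 5"
  using min_degree [of l] by (auto simp: L_def)

lemma heavy_final_charge:
  assumes x: "x \<in> H"
  shows "(\<Sum>e\<in>light_at x. demand e) \<le> real (degree G x) - 6 + (\<Sum>f\<in>F. excess x f) / 2"
proof -
  define t where "t = card (light_at x)"
  define p where "p = card (heavy_at x)"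
  define n where "n = degree G x"
  have fin: "finite (light_at x)" "finite (heavy_at x)"
    using finite_E by (auto simp: light_at_def heavy_at_def)
  have "{e \<in> E. x \<in> e} = light_at x \<union> heavy_at x" "light_at x \<inter> heavy_at x = {}"
    by (auto simp: light_at_def heavy_at_def)
  then have n: "n = t + p"
    unfolding n_def t_def p_def degree_def using fin by (simp add: card_Un_disjoint)
  have n6: "6 \<le> n" using x by (auto simp: n_def H_def L_def)
  have nbr: "\<exists>l. l \<in> L \<and> demand e = (6 - real (degree G l)) / real (degree G l) \<and> 14 \<le> degree G l + n"
    if "e \<in> light_at x" for e
  proof -
    have e: "e \<in> E" "e \<inter> L \<noteq> {}" "x \<in> e" using that by (auto simp: light_at_def)
    obtain l y where ly: "e = {l, y}" "l \<in> L" "y \<in> H" "14 \<le> degree G l + degree G y"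
      using light_edge [OF e(1,2)] by metis
    then have "y = x" using x e finite_LH(3) by auto
    then show ?thesis using ly demand_eq by (auto simp: n_def)
  qed
  have bound: "(\<Sum>e\<in>light_at x. demand e) \<le> real t * c"
    if "\<And>l. l \<in> L \<Longrightarrow> 14 \<le> degree G l + n \<Longrightarrow> (6 - real (degree G l)) / real (degree G l) \<le> c" for c
    unfolding t_def by (rule sum_bounded_above) (use nbr that in force)
  note ex = excess_ge [of x, folded t_def p_def]
  \<comment> \<open>A light neighbour has degree at least 14 - n, and degrees 3, 4, 5 demand 1, 1/2,
    1/5 per edge. So the demand per edge is at most 1, 1/2, 1/5 in the first three cases, and in the
    last there is no light edge.\<close>
  consider "n \<ge> 11" | "n = 10" | "n = 9" | "n \<le> 8" by linarith
  then show ?thesis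
  proof cases
    case 1
    have "(\<Sum>e\<in>light_at x. demand e) \<le> real t * 1"
      by (rule bound) (auto dest!: light_degree_cases)
    moreover have "real t \<le> real n - 6 + (\<Sum>f\<in>F. excess x f) / 2"
    \<comment> \<open>With six heavy edges the own charge t + p - 6 covers the demand t. Otherwise t
      is at least 6, and half of the excess adds t - p, which gives 2t - 6.\<close>
    proof (cases "6 \<le> p")
      case True then show ?thesis using n ex by simp
    next
      case False
      then have "t \<ge> 6" using n 1 by simp
      then show ?thesis using n ex by simp
    qed
    ultimately show ?thesis by (simp add: n_def)
  next
    case 2
    have "(\<Sum>e\<in>light_at x. demand e) \<le> real t * (1 / 2)"
      by (rule bound) (use 2 in \<open>auto dest!: light_degree_cases\<close>)
    moreover have "real t / 2 \<le> real n - 6 + (\<Sum>f\<in>F. excess x f) / 2"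
    \<comment> \<open>The own charge 4 covers t/2 up to t = 8. Beyond that p is at most 1, and half
      of the excess adds at least 8.\<close>
    proof (cases "t \<le> 8")
      case True then show ?thesis using ex 2 by simp
    next
      case False then show ?thesis using n ex 2 by simp
    qed
    ultimately show ?thesis by (simp add: n_def)
  next
    case 3
    have "(\<Sum>e\<in>light_at x. demand e) \<le> real t * (1 / 5)"
      by (rule bound) (use 3 in \<open>auto dest!: light_degree_cases\<close>)
    then show ?thesis using n ex(1) 3 by (simp add: n_def)
  next
    case 4
    have "light_at x = {}" using nbr 4 light_degree_cases by fastforce
    then show ?thesis using ex(1) n6 by (simp add: n_def)
  qed
qed

text \<open>Each light edge is charged once, at its only heavy end. Regrouped by light ends, the
  equal parts along all edges at \<open>l\<close> add up to what \<open>l\<close> lacks.\<close>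

lemma light_demand: "(\<Sum>x\<in>H. \<Sum>e\<in>light_at x. demand e) = (\<Sum>l\<in>L. 6 - real (degree G l))"
proof -
  let ?X = "{e \<in> E. e \<inter> L \<noteq> {}}"
  have X: "finite ?X" using finite_E by simp
  have "(\<Sum>x\<in>H. \<Sum>e\<in>light_at x. demand e) = (\<Sum>x\<in>H. \<Sum>e | e \<in> ?X \<and> x \<in> e. demand e)"
    by (simp add: light_at_def conj_assoc)
  also have "\<dots> = (\<Sum>e\<in>?X. real (card (H \<inter> e)) * demand e)"
    by (rule sum_incident [OF finite_LH(2) X])
  also have "\<dots> = (\<Sum>e\<in>?X. demand e)"
    using light_edge_card by (intro sum.cong) auto
  also have "\<dots> = (\<Sum>e\<in>E. demand e)"
    using finite_E by (intro sum.mono_neutral_left) (auto simp: demand_def Int_commute)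
  also have "\<dots> = (\<Sum>e\<in>E. \<Sum>l | l \<in> L \<and> l \<in> e. (6 - real (degree G l)) / real (degree G l))"
    by (simp add: demand_def Int_def)
  also have "\<dots> = (\<Sum>l\<in>L. \<Sum>e | e \<in> E \<and> l \<in> e. (6 - real (degree G l)) / real (degree G l))"
    by (rule sum.swap_restrict [symmetric]) (use finite_LH finite_E in auto)
  also have "\<dots> = (\<Sum>l\<in>L. 6 - real (degree G l))"
  proof (rule sum.cong)
    fix l assume "l \<in> L"
    then have "degree G l \<noteq> 0" using light_degree_cases by fastforce
    then show "(\<Sum>e | e \<in> E \<and> l \<in> e. (6 - real (degree G l)) / real (degree G l)) = 6 - real (degree G l)"
      by (simp flip: degree_def)
  qed simp
  finally show ?thesis .
qed

text \<open>The heavy vertices and the faces together cover what the light vertices lack, so the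
  total charge would be nonnegative, yet it is at most -12.\<close>

lemma contradiction: False
proof -
  have "(\<Sum>l\<in>L. 6 - real (degree G l)) \<le> (\<Sum>x\<in>H. real (degree G x) - 6 + (\<Sum>f\<in>F. excess x f) / 2)"
    unfolding light_demand [symmetric] by (intro sum_mono heavy_final_charge)
  also have "\<dots> = (\<Sum>x\<in>H. real (degree G x) - 6) + (\<Sum>f\<in>F. \<Sum>x\<in>H. excess x f) / 2"
    by (simp add: sum.distrib sum.swap [of _ F] flip: sum_divide_distrib)
  also have "(\<Sum>f\<in>F. \<Sum>x\<in>H. excess x f) \<le> (\<Sum>f\<in>F. 2 * (2 * len f - 6))"
    by (intro sum_mono excess_le_face)
  also have "\<dots> = 2 * (\<Sum>f\<in>F. 2 * len f - 6)"
    by (rule sum_distrib_left [symmetric])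
  finally have "(\<Sum>l\<in>L. 6 - real (degree G l)) \<le> (\<Sum>x\<in>H. real (degree G x) - 6) + (\<Sum>f\<in>F. 2 * len f - 6)"
    by simp
  moreover have "(\<Sum>v\<in>V. real (degree G v) - 6) = (\<Sum>x\<in>L. real (degree G x) - 6) + (\<Sum>x\<in>H. real (degree G x) - 6)"
    unfolding finite_LH(4) [symmetric] by (rule sum.union_disjoint) (use finite_LH in auto)
  moreover have "(\<Sum>l\<in>L. 6 - real (degree G l)) = - (\<Sum>x\<in>L. real (degree G x) - 6)"
    by (simp flip: sum_negf)
  ultimately show False using total_charge by linarith
qed

end

theorem light_edge_exists:
  fixes G :: "'a graph"
  assumes G: "finite_simple_graph G" "planar G"
    and "verts G \<noteq> {}" and min_degree: "\<And>v. v \<in> verts G \<Longrightarrow> 3 \<le> degree G v"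
  obtains (light) u v where "{u, v} \<in> edges G" "degree G u \<le> 5" "degree G u + degree G v \<le> 13"
proof (rule ccontr)
  assume neg: "\<not> thesis"
  obtain p g where "plane_drawing G p g" using G(2) unfolding planar_def by blast
  then interpret plane_graph G p g using G(1) by unfold_locales
  \<comment> \<open>Three edges at a vertex \<open>v\<close> and a further one at a neighbour
    \<open>u\<close>, which avoids \<open>v\<close> because the graph is simple.\<close>
  have "4 \<le> card E"
  proof -
    have deg: "3 \<le> card {e \<in> E. v \<in> e}" if "v \<in> V" for v
      using min_degree [OF that] by (simp add: degree_def)
    obtain v where v: "v \<in> V" using assms(3) by blast
    have "{e \<in> E. v \<in> e} \<noteq> {}"
    proof
      assume none: "{e \<in> E. v \<in> e} = {}"
      show False using deg [OF v] unfolding none by simp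
    qed
    then obtain e where e: "e \<in> E" "v \<in> e" by blast
    obtain u where u: "e = {v, u}" "u \<noteq> v"
      using other_end [OF edge(2) [OF e(1)] e(2)] by metis
    have "u \<in> V" using e u edge(1) by blast
    have "\<not> {e \<in> E. u \<in> e} \<subseteq> {e}"
    proof
      assume "{e \<in> E. u \<in> e} \<subseteq> {e}"
      then have "card {e \<in> E. u \<in> e} \<le> card {e}" by (rule card_mono [rotated]) simp
      then show False using deg [OF \<open>u \<in> V\<close>] by simp
    qed
    then obtain e' where e': "e' \<in> E" "u \<in> e'" "e' \<noteq> e" by blast
    have "v \<notin> e'"
    proof
      assume "v \<in> e'"
      then have "{v, u} \<subseteq> e'" "card e' = 2" using e' edge(2) by auto
      then have "{v, u} = e'"
        using u(2) by (intro card_seteq) (auto intro: card_ge_0_finite)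
      then have "e' = e" using u by simp
      then show False using e' by blast
    qed
    then have "card (insert e' {e \<in> E. v \<in> e}) = card {e \<in> E. v \<in> e} + 1"
      using finite_E by simp
    moreover have "card (insert e' {e \<in> E. v \<in> e}) \<le> card E"
      using e' finite_E by (intro card_mono) auto
    ultimately show ?thesis using deg [OF v] by linarith
  qed
  then show False
  proof (rule face_weights)
    fix F :: "complex set set" and w :: "'a set \<Rightarrow> complex set \<Rightarrow> nat"
    assume weights: "finite F" "card E + 2 \<le> card F + card V"
      "\<And>e. e \<in> E \<Longrightarrow> (\<Sum>f\<in>F. w e f) = 2"
      "\<And>f. f \<in> F \<Longrightarrow> 4 \<le> card {e \<in> E. w e f \<noteq> 0} \<or> triangle {e \<in> E. w e f \<noteq> 0}"
    have "14 \<le> degree G u + degree G v" if "{u, v} \<in> E" "degree G u \<le> 5" for u v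
    proof (rule ccontr)
      assume "\<not> ?thesis"
      then have "degree G u + degree G v \<le> 13" by simp
      then show False using neg light [OF that] by blast
    qed
    then have "discharging G F w"
      using weights G(1) min_degree by (intro discharging.intro)
    then show False by (rule discharging.contradiction)
  qed
qed

section \<open>The total graph\<close>

text \<open>The vertex \<open>y\<close> with few neighbours in \<open>Y\<close> goes to the end of
  the ordering, and the rest of \<open>Y\<close> is ordered by induction. The predecessors adjacent
  to \<open>y\<close> are then among its neighbours in \<open>Y\<close>.\<close>

lemma coloring_number_le:
  assumes fin: "finite (verts H)"
    and deg: "\<And>Y. Y \<subseteq> verts H \<Longrightarrow> Y \<noteq> {} \<Longrightarrow> \<exists>y\<in>Y. card {z \<in> Y. {z, y} \<in> edges H} < m"
  shows "coloring_number H \<le> m"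
proof -
  have "\<exists>xs. distinct xs \<and> set xs = Y \<and> (\<forall>i<length xs. card {j. j < i \<and> {xs ! j, xs ! i} \<in> edges H} < m)"
    if "finite Y" "Y \<subseteq> verts H" for Y
    using that
  proof (induction "card Y" arbitrary: Y)
    case 0
    then show ?case by (intro exI [of _ "[]"]) simp
  next
    case (Suc n)
    then have "Y \<noteq> {}" by auto
    then obtain y where y: "y \<in> Y" "card {z \<in> Y. {z, y} \<in> edges H} < m"
      using deg [OF Suc.prems(2)] by blast
    have "n = card (Y - {y})" using Suc.hyps(2) Suc.prems(1) y(1) by simp
    then obtain xs where xs: "distinct xs" "set xs = Y - {y}"
      "\<And>i. i < length xs \<Longrightarrow> card {j. j < i \<and> {xs ! j, xs ! i} \<in> edges H} < m"
      using Suc.hyps(1) [of "Y - {y}"] Suc.prems by blast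
    have "card {j. j < i \<and> {(xs @ [y]) ! j, (xs @ [y]) ! i} \<in> edges H} < m"
      if i: "i < length (xs @ [y])" for i
    proof (cases "i < length xs")
      case True
      then have "{j. j < i \<and> {(xs @ [y]) ! j, (xs @ [y]) ! i} \<in> edges H} =
          {j. j < i \<and> {xs ! j, xs ! i} \<in> edges H}"
        by (auto simp: nth_append)
      then show ?thesis using xs(3) [OF True] by simp
    next
      case False
      then have i: "i = length xs" using i by simp
      let ?J = "{j. j < i \<and> {(xs @ [y]) ! j, (xs @ [y]) ! i} \<in> edges H}"
      have "card ?J \<le> card {z \<in> Y. {z, y} \<in> edges H}"
      proof (rule card_inj_on_le)
        show "inj_on (nth xs) ?J"
          using xs(1) i by (auto simp: inj_on_def nth_eq_iff_index_eq)
        show "nth xs ` ?J \<subseteq> {z \<in> Y. {z, y} \<in> edges H}"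
        proof
          fix z assume "z \<in> nth xs ` ?J"
          then obtain j where "j < length xs" "z = xs ! j" "{xs ! j, y} \<in> edges H"
            using i by (auto simp: nth_append)
          then show "z \<in> {z \<in> Y. {z, y} \<in> edges H}"
            using xs(2) nth_mem by blast
        qed
        show "finite {z \<in> Y. {z, y} \<in> edges H}" using Suc.prems(1) by simp
      qed
      then show ?thesis using y(2) by simp
    qed
    moreover have "distinct (xs @ [y])" "set (xs @ [y]) = Y" using xs y(1) by auto
    ultimately show ?case by blast
  qed
  then obtain xs where "vertex_ordering H xs"
    "\<forall>i<length xs. card {j. j < i \<and> {xs ! j, xs ! i} \<in> edges H} < m"
    unfolding vertex_ordering_def using fin by blast
  then show ?thesis unfolding coloring_number_def by (intro Least_le) blast
qed

section \<open>No dense part in the total graph\<close>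

lemma planar_subgraph:
  assumes "planar G" "verts G' \<subseteq> verts G" "edges G' \<subseteq> edges G" "finite_simple_graph G'"
  shows "planar G'"
proof -
  obtain p g where "plane_drawing G p g" using assms(1) unfolding planar_def by blast
  then have pg: "inj_on p (verts G)"
    "\<And>e. e \<in> edges G \<Longrightarrow> arc (g e) \<and> {pathstart (g e), pathfinish (g e)} = p ` e \<and>
      path_image (g e) \<inter> p ` verts G = p ` e"
    "\<And>e f. e \<in> edges G \<Longrightarrow> f \<in> edges G \<Longrightarrow> e \<noteq> f \<Longrightarrow>
      path_image (g e) \<inter> path_image (g f) = p ` (e \<inter> f)"
    unfolding plane_drawing_def by simp_all
  have "path_image (g e) \<inter> p ` verts G' = p ` e" if e: "e \<in> edges G'" for e
  proof
    have "e \<subseteq> verts G'" using assms(4) e by (simp add: finite_simple_graph_def)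
    then show "p ` e \<subseteq> path_image (g e) \<inter> p ` verts G'"
      using pg(2) [of e] e assms(3) by blast
    show "path_image (g e) \<inter> p ` verts G' \<subseteq> p ` e"
      using pg(2) [of e] e assms(2,3) by blast
  qed
  then have "plane_drawing G' p g"
    unfolding plane_drawing_def
    using pg inj_on_subset [OF pg(1) assms(2)] assms(3) by (simp add: subset_iff)
  then show ?thesis unfolding planar_def by blast
qed

lemma total_graph_edge_simps:
  "{Inl u, Inl v} \<in> edges (total_graph G) \<longleftrightarrow> {u, v} \<in> edges G"
  "{Inr e, Inr f} \<in> edges (total_graph G) \<longleftrightarrow> e \<in> edges G \<and> f \<in> edges G \<and> e \<noteq> f \<and> e \<inter> f \<noteq> {}"
  "{Inl v, Inr e} \<in> edges (total_graph G) \<longleftrightarrow> e \<in> edges G \<and> v \<in> e"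
  "{Inr e, Inl v} \<in> edges (total_graph G) \<longleftrightarrow> e \<in> edges G \<and> v \<in> e"
  unfolding total_graph_def by (auto simp: doubleton_eq_iff insert_commute)

lemma total_graph_sparse:
  fixes G :: "'a graph"
  assumes k: "k \<ge> 11" and G: "finite_simple_graph G" "planar G" and max: "max_degree G \<le> k"
    and Y: "Y \<subseteq> verts (total_graph G)" "Y \<noteq> {}"
  shows "\<exists>y\<in>Y. card {z \<in> Y. {z, y} \<in> edges (total_graph G)} < k + 2"
proof (rule ccontr)
  assume "\<not> ?thesis"
  then have dense: "k + 2 \<le> card {z \<in> Y. {z, y} \<in> edges (total_graph G)}" if "y \<in> Y" for y
    using that by fastforce
  define W where "W = {v. Inl v \<in> Y}"
  define F where "F = {e. Inr e \<in> Y}"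
  define I where "I = {e \<in> edges G. e \<subseteq> W}"
  \<comment> \<open>Only edges in \<open>F\<close> count here, being elements of \<open>Y\<close>.
    The degree in \<open>G'\<close> can be larger, but only at vertices of \<open>W\<close>, through
    edges of \<open>I\<close>.\<close>
  define d where "d v = card {e \<in> F. v \<in> e}" for v
  define G' where "G' = \<lparr>verts = W \<union> \<Union>F, edges = F \<union> I\<rparr>"
  have Y_eq: "Y = Inl ` W \<union> Inr ` F"
  proof (intro set_eqI)
    fix y show "y \<in> Y \<longleftrightarrow> y \<in> Inl ` W \<union> Inr ` F"
      by (cases y) (auto simp: W_def F_def)
  qed
  have sub: "W \<subseteq> verts G" "F \<subseteq> edges G" "I \<subseteq> edges G"
    using Y(1) by (auto simp: W_def F_def I_def total_graph_def)
  have edge: "e \<subseteq> verts G" "card e = 2" if "e \<in> edges G" for e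
    using G(1) that by (auto simp: finite_simple_graph_def)
  have fin_V: "finite (verts G)" using G(1) by (simp add: finite_simple_graph_def)
  have fin: "finite (edges G)" using G(1) by (rule finite_edges)
  have fin': "finite W" "finite F" "finite I"
    using sub fin fin_V finite_subset by blast+
  have d_le: "d v \<le> k" for v
  proof (cases "v \<in> verts G")
    case True
    have "degree G v \<le> k"
      using max True fin_V unfolding max_degree_def by auto
    moreover have "d v \<le> degree G v"
      unfolding d_def degree_def by (rule card_mono) (use fin sub in auto)
    ultimately show ?thesis by simp
  next
    case False
    then have "{e \<in> F. v \<in> e} = {}" using sub edge by blast
    then show ?thesis unfolding d_def by (simp only: card.empty le0)
  qed
  have "\<Union>F \<subseteq> verts G" using sub edge by blast
  then have "finite (\<Union>F)" using fin_V by (rule finite_subset)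
  then have G': "finite_simple_graph G'"
    using fin' sub edge unfolding G'_def finite_simple_graph_def by (auto simp: I_def)
  have planar: "planar G'"
    by (rule planar_subgraph [OF G(2) _ _ G']) (use sub \<open>\<Union>F \<subseteq> verts G\<close> in \<open>simp_all add: G'_def\<close>)
  have deg': "d v \<le> degree G' v" "v \<notin> W \<Longrightarrow> degree G' v = d v" for v
  proof -
    show "d v \<le> degree G' v"
      unfolding d_def degree_def by (rule card_mono) (use fin' in \<open>auto simp: G'_def\<close>)
    assume "v \<notin> W"
    then have "{e \<in> edges G'. v \<in> e} = {e \<in> F. v \<in> e}" by (auto simp: G'_def I_def)
    then show "degree G' v = d v" by (simp add: d_def degree_def)
  qed
  \<comment> \<open>Neighbours of \<open>v\<close> in \<open>W\<close> inject into its edges of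
    \<open>G'\<close>, and its neighbours in \<open>F\<close> are such edges too. So twice the
    degree is at least k + 2, hence at least 13.\<close>
  have W_deg: "7 \<le> degree G' v" if v: "v \<in> W" for v
  proof -
    let ?N = "{u \<in> W. {u, v} \<in> edges G}" and ?M = "{e \<in> F. v \<in> e}"
    have "{z \<in> Y. {z, Inl v} \<in> edges (total_graph G)} \<subseteq> Inl ` ?N \<union> Inr ` ?M"
      unfolding Y_eq by (auto simp: total_graph_edge_simps)
    then have "card {z \<in> Y. {z, Inl v} \<in> edges (total_graph G)} \<le> card (Inl ` ?N \<union> Inr ` ?M)"
      using fin' by (intro card_mono) auto
    also have "\<dots> \<le> card (Inl ` ?N :: ('a + 'a set) set) + card (Inr ` ?M :: ('a + 'a set) set)"
      by (rule card_Un_le)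
    also have "\<dots> = card ?N + d v" by (simp add: card_image d_def)
    also have "card ?N \<le> degree G' v"
      unfolding degree_def
    proof (rule card_inj_on_le)
      show "inj_on (\<lambda>u. {u, v}) ?N" by (auto simp: inj_on_def doubleton_eq_iff)
      show "(\<lambda>u. {u, v}) ` ?N \<subseteq> {e \<in> edges G'. v \<in> e}"
        using v by (auto simp: G'_def I_def)
      show "finite {e \<in> edges G'. v \<in> e}" using fin' by (simp add: G'_def)
    qed
    finally have "k + 2 \<le> 2 * degree G' v"
      using dense [of "Inl v"] v deg'(1) [of v] by (simp add: W_def)
    then show ?thesis using k by simp
  qed
  \<comment> \<open>Both \<open>d u\<close> and \<open>d v\<close> count the edge \<open>uv\<close>
    itself, which is no neighbour of its own; this turns k + 2 into k + 4.\<close>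
  have F_deg: "k + 4 \<le> d u + d v + card (W \<inter> {u, v})" if e: "{u, v} \<in> F" for u v
  proof -
    let ?M = "\<lambda>x. {f \<in> F. x \<in> f} - {{u, v}}"
    have M: "card (?M x) + 1 = d x" if "x \<in> {u, v}" for x
      unfolding d_def Suc_eq_plus1 [symmetric]
      by (rule card.remove [symmetric]) (use that e fin' in auto)
    have "{z \<in> Y. {z, Inr {u, v}} \<in> edges (total_graph G)} \<subseteq>
        Inl ` (W \<inter> {u, v}) \<union> Inr ` (?M u \<union> ?M v)"
      unfolding Y_eq by (auto simp: total_graph_edge_simps)
    then have "card {z \<in> Y. {z, Inr {u, v}} \<in> edges (total_graph G)} \<le>
        card (Inl ` (W \<inter> {u, v}) \<union> Inr ` (?M u \<union> ?M v))"
      using fin' by (intro card_mono) auto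
    also have "\<dots> \<le> card (Inl ` (W \<inter> {u, v}) :: ('a + 'a set) set) +
        card (Inr ` (?M u \<union> ?M v) :: ('a + 'a set) set)"
      by (rule card_Un_le)
    also have "\<dots> = card (W \<inter> {u, v}) + card (?M u \<union> ?M v)" by (simp add: card_image)
    also have "card (?M u \<union> ?M v) \<le> card (?M u) + card (?M v)" by (rule card_Un_le)
    finally show ?thesis
      using dense [of "Inr {u, v}"] e M [of u] M [of v] by (simp add: F_def)
  qed
  have "3 \<le> degree G' v" if v: "v \<in> verts G'" for v
  proof (cases "v \<in> W")
    case True then show ?thesis using W_deg by fastforce
  next
    case False
    then obtain e where e: "e \<in> F" "v \<in> e" using v by (auto simp: G'_def)
    then have "card e = 2" using edge(2) sub(2) by blast
    then obtain u where u: "e = {u, v}" "u \<noteq> v"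
      using other_end [OF _ e(2)] by (metis insert_commute)
    \<comment> \<open>With at most one end in \<open>W\<close> and \<open>d u\<close> at most k, at
      least 3 remains for \<open>d v\<close>.\<close>
    have "card (W \<inter> {u, v}) \<le> card {u}" using False by (intro card_mono) auto
    then show ?thesis
      using F_deg [of u v] e u d_le [of u] deg'(1) [of v] by simp
  qed
  moreover have "verts G' \<noteq> {}"
  proof -
    have "W \<noteq> {} \<or> F \<noteq> {}" using Y(2) Y_eq by auto
    moreover have "e \<noteq> {}" if "e \<in> F" for e using that sub edge(2) by fastforce
    ultimately show ?thesis by (auto simp: G'_def)
  qed
  ultimately obtain u v where uv: "{u, v} \<in> edges G'" "degree G' u \<le> 5" "degree G' u + degree G' v \<le> 13"
    using light_edge_exists [OF G' planar] by metis
  \<comment> \<open>Being outside \<open>W\<close>, the light end keeps the edge out of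
    \<open>I\<close>, so \<open>F_deg\<close> applies with at most one end in \<open>W\<close> and
    gives a degree sum of at least k + 3, hence 14.\<close>
  have "u \<notin> W" using uv(2) W_deg by fastforce
  then have "{u, v} \<in> F" using uv(1) by (auto simp: G'_def I_def)
  moreover have "card (W \<inter> {u, v}) \<le> card {v}" using \<open>u \<notin> W\<close> by (intro card_mono) auto
  ultimately show False
    using F_deg [of u v] uv(3) deg'(1) [of u] deg'(1) [of v] k by simp
qed

theorem theorem6:
  fixes G :: "'a graph" and k :: nat
  assumes "k \<ge> 11"
    and "finite_simple_graph G"
    and "planar G"
    and "max_degree G \<le> k"
  shows "coloring_number (total_graph G) \<le> k + 2"
proof (rule coloring_number_le)
  show "finite (verts (total_graph G))"
    using assms(2) finite_edges by (auto simp: total_graph_def finite_simple_graph_def)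
next
  fix Y assume "Y \<subseteq> verts (total_graph G)" "Y \<noteq> {}"
  then show "\<exists>y\<in>Y. card {z \<in> Y. {z, y} \<in> edges (total_graph G)} < k + 2"
    by (rule total_graph_sparse [OF assms])
qed

end
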